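(* Let $G$ be a finite simple graph of order at least $7$. If $G$ is $2$-connected and $G$ is a $[4,2]$-graph, then $G$ is pancyclic.
   Context: For integers $s,t$, a graph $G$ is called an $[s,t]$-graph if every induced subgraph of $G$ on $s$ vertices has at least $t$ edges. A graph $G$ of order $n$ is pancyclic if for every integer $k$ with $3\le k\le n$, $G$ contains a cycle of length $k$. *)

theory Defs
  imports Main
begin

definition simple_graph :: "'a set \<Rightarrow> ('a \<Rightarrow> 'a \<Rightarrow> bool) \<Rightarrow> bool" where
  "simple_graph V E \<longleftrightarrow> finite V \<and> (\<forall>u v. E u v \<longrightarrow> u \<in> V \<and> v \<in> V)
     \<and> (\<forall>u v. E u v \<longrightarrow> E v u) \<and> (\<forall>v. \<not> E v v)"

definition induced_edges :: "('a \<Rightarrow> 'a \<Rightarrow> bool) \<Rightarrow> 'a set \<Rightarrow> 'a set set" where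
  "induced_edges E S = {{u, v} | u v. u \<in> S \<and> v \<in> S \<and> E u v}"

definition st_graph :: "nat \<Rightarrow> nat \<Rightarrow> 'a set \<Rightarrow> ('a \<Rightarrow> 'a \<Rightarrow> bool) \<Rightarrow> bool" where
  "st_graph s t V E \<longleftrightarrow> (\<forall>S. S \<subseteq> V \<and> card S = s \<longrightarrow> t \<le> card (induced_edges E S))"

definition is_walk :: "('a \<Rightarrow> 'a \<Rightarrow> bool) \<Rightarrow> 'a list \<Rightarrow> bool" where
  "is_walk E xs \<longleftrightarrow> xs \<noteq> [] \<and> (\<forall>i. Suc i < length xs \<longrightarrow> E (xs ! i) (xs ! Suc i))"

definition connected_on :: "'a set \<Rightarrow> ('a \<Rightarrow> 'a \<Rightarrow> bool) \<Rightarrow> bool" where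
  "connected_on W E \<longleftrightarrow> W \<noteq> {} \<and> (\<forall>u\<in>W. \<forall>v\<in>W. \<exists>xs. is_walk E xs \<and> set xs \<subseteq> W
        \<and> hd xs = u \<and> last xs = v)"

definition two_connected :: "'a set \<Rightarrow> ('a \<Rightarrow> 'a \<Rightarrow> bool) \<Rightarrow> bool" where
  "two_connected V E \<longleftrightarrow> 3 \<le> card V \<and> connected_on V E \<and> (\<forall>x\<in>V. connected_on (V - {x}) E)"

definition has_cycle_of_length :: "'a set \<Rightarrow> ('a \<Rightarrow> 'a \<Rightarrow> bool) \<Rightarrow> nat \<Rightarrow> bool" where
  "has_cycle_of_length V E k \<longleftrightarrow> 3 \<le> k \<and> (\<exists>xs. length xs = k \<and> distinct xs \<and> set xs \<subseteq> V
      \<and> is_walk E xs \<and> E (last xs) (hd xs))"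

definition pancyclic :: "'a set \<Rightarrow> ('a \<Rightarrow> 'a \<Rightarrow> bool) \<Rightarrow> bool" where
  "pancyclic V E \<longleftrightarrow> (\<forall>k. 3 \<le> k \<and> k \<le> card V \<longrightarrow> has_cycle_of_length V E k)"

end

theory Submission
  imports Defs
begin

text \<open>
  The graph contains a triangle because the Ramsey number \<open>R(3,3)\<close> is 6 and, in a triangle-free
  graph, the vertices outside an independent triple would be pairwise nonadjacent. From there a
  cycle \<open>C\<close> of length \<open>k < n\<close> is always extended to one of length \<open>k + 1\<close>. If this were impossible,
  a vertex \<open>x\<close> off \<open>C\<close> with two neighbours on \<open>C\<close> would form an independent triple with their
  successors, and likewise with their predecessors; three neighbours thus violate the
  [4,2]-condition, and with two neighbours the forced chords reroute \<open>C\<close> through \<open>x\<close>. So every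
  vertex off \<open>C\<close> has at most one neighbour on \<open>C\<close>. If \<open>k \<ge> 4\<close>, the vertices off \<open>C\<close> then form a
  clique, and by 2-connectedness there are disjoint edges \<open>x p\<close> and \<open>y q\<close> leaving \<open>C\<close>; the rest of
  \<open>C\<close> is a clique as well, which for \<open>k \<ge> 5\<close> gives a path from \<open>p\<close> to \<open>q\<close> missing one vertex of \<open>C\<close>; for
  \<open>k = 4\<close> a third vertex off \<open>C\<close> may have to be inserted between \<open>x\<close> and \<open>y\<close>. If \<open>k = 3\<close>, every further
  vertex is adjacent to both \<open>x\<close> and \<open>y\<close>, and two of them close a 4-cycle.
\<close>

section \<open>Cycles as vertex lists, rotations and crossing edges\<close>

text \<open>Written with \<open>successively\<close>, so that rotated and rerouted vertex lists can
  be checked by its append and cons rules. The lower bound 3 on the length is kept apart, see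
  \<open>has_cycle_iff\<close>.\<close>

definition cycle :: "'a set \<Rightarrow> ('a \<Rightarrow> 'a \<Rightarrow> bool) \<Rightarrow> 'a list \<Rightarrow> bool" where
  "cycle V E xs \<longleftrightarrow> distinct xs \<and> set xs \<subseteq> V \<and> successively E xs \<and> E (last xs) (hd xs)"

lemma is_walk_iff: "is_walk E xs \<longleftrightarrow> xs \<noteq> [] \<and> successively E xs"
  by (simp add: is_walk_def successively_conv_nth)

lemma has_cycle_iff:
  "has_cycle_of_length V E k \<longleftrightarrow> 3 \<le> k \<and> (\<exists>xs. length xs = k \<and> cycle V E xs)"
  unfolding has_cycle_of_length_def cycle_def is_walk_iff by fastforce

lemma cycle_rotate: "cycle V E (xs @ ys) \<Longrightarrow> cycle V E (ys @ xs)"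
  by (cases "xs = []"; cases "ys = []")
    (auto simp: cycle_def successively_append_iff)

lemma cycle_starting_at:
  assumes "cycle V E xs" "u \<in> set xs"
  obtains ys where "cycle V E (u # ys)" "set (u # ys) = set xs" "length (u # ys) = length xs"
proof -
  obtain as bs where "xs = as @ u # bs" using assms(2) split_list by metis
  then show ?thesis using that[of "bs @ as"] assms(1) cycle_rotate[of V E as "u # bs"] by auto
qed

lemma cycle_split_at:
  assumes "cycle V E xs" "u \<in> set xs" "v \<in> set xs" "u \<noteq> v"
  obtains A B where "cycle V E (u # A @ v # B)" "set (u # A @ v # B) = set xs"
    "length (u # A @ v # B) = length xs"
proof -
  obtain ys where ys: "cycle V E (u # ys)" "set (u # ys) = set xs" "length (u # ys) = length xs"
    using cycle_starting_at[OF assms(1,2)] .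
  then have "v \<in> set ys" using assms(3,4) by auto
  then obtain A B where "ys = A @ v # B" using split_list by metis
  then show ?thesis using that ys by auto
qed

lemma successively_clique:
  assumes "distinct xs" "\<And>u v. u \<in> set xs \<Longrightarrow> v \<in> set xs \<Longrightarrow> u \<noteq> v \<Longrightarrow> E u v"
  shows "successively E xs"
  using assms by (auto simp: successively_conv_nth nth_eq_iff_index_eq)

text \<open>A walk from \<open>S\<close> to its complement has a step that leaves \<open>S\<close>.
  Applied both to \<open>V\<close> and to \<open>V\<close> with one vertex deleted.\<close>

lemma connected_on_crossing_edge:
  assumes "connected_on W E" "S \<subseteq> W" "S \<noteq> {}" "W - S \<noteq> {}"
  obtains u v where "u \<in> S" "v \<in> W - S" "E u v"
proof -
  obtain s t where st: "s \<in> S" "t \<in> W - S" using assms by blast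
  then obtain xs where xs: "is_walk E xs" "set xs \<subseteq> W" "hd xs = s" "last xs = t"
    using assms unfolding connected_on_def by blast
  have "\<exists>u\<in>S. \<exists>v\<in>W - S. E u v"
    if "xs \<noteq> []" "successively E xs" "set xs \<subseteq> W" "hd xs \<in> S" "last xs \<in> W - S" for xs
    using that
  proof (induction xs rule: induct_list012)
    case (3 a b xs)
    then show ?case by (cases "b \<in> S") auto
  qed auto
  then show ?thesis using that st xs unfolding is_walk_iff by blast
qed

lemma card_ge_2_obtain:
  assumes "2 \<le> card S"
  obtains a b where "a \<in> S" "b \<in> S" "a \<noteq> b"
  using assms card_le_Suc0_iff_eq[of S] card_eq_0_iff[of S] by force

lemma card_ge_3_obtain:
  assumes "3 \<le> card S"
  obtains a b c where "a \<in> S" "b \<in> S" "c \<in> S" "a \<noteq> b" "a \<noteq> c" "b \<noteq> c"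
proof -
  obtain T where T: "T \<subseteq> S" "card T = 3" using assms by (meson obtain_subset_with_card_n)
  then show ?thesis using that unfolding card_3_iff by blast
qed

section \<open>The [4,2]-condition on four vertices\<close>

locale graph_4_2 =
  fixes V :: "'a set" and E :: "'a \<Rightarrow> 'a \<Rightarrow> bool"
  assumes simple: "simple_graph V E"
    and order: "7 \<le> card V"
    and st: "st_graph 4 2 V E"
begin

lemma fin: "finite V" and sym: "E u v \<Longrightarrow> E v u" and irrefl: "\<not> E v v"
  and edge_in: "E u v \<Longrightarrow> u \<in> V" "E u v \<Longrightarrow> v \<in> V"
  using simple unfolding simple_graph_def by blast+

text \<open>\<open>c d\<close> is the only pair left that may be an edge. Typical use: four known
  non-edges force a fifth pair to be adjacent.\<close>

lemma no_five_nonedges: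
  assumes "{a, b, c, d} \<subseteq> V" "distinct [a, b, c, d]"
    and "\<not> E a b" "\<not> E a c" "\<not> E a d" "\<not> E b c" "\<not> E b d"
  shows False
proof -
  have "induced_edges E {a, b, c, d} \<subseteq> {{c, d}}"
    using assms sym irrefl unfolding induced_edges_def by auto
  then have "card (induced_edges E {a, b, c, d}) \<le> 1"
    using card_mono[of "{{c, d}}"] by simp
  moreover have "card {a, b, c, d} = 4" using assms(2) by simp
  then have "2 \<le> card (induced_edges E {a, b, c, d})"
    using st assms(1) unfolding st_graph_def by blast
  ultimately show False by simp
qed

text \<open>Two pairs missing at \<open>d\<close> would, together with the three in the triple, make
  five non-edges.\<close>

lemma two_neighbours_in_triple:
  assumes "{a, b, c, d} \<subseteq> V" "distinct [a, b, c, d]" "\<not> E a b" "\<not> E a c" "\<not> E b c"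
  shows "E d a \<and> E d b \<or> E d a \<and> E d c \<or> E d b \<and> E d c"
  using no_five_nonedges[of a b c d] no_five_nonedges[of a c b d] no_five_nonedges[of b c a d]
    assms sym by auto

lemma card_minus: "card (V - set xs) \<ge> card V - length xs"
  using diff_card_le_card_Diff[of "set xs" V] card_length[of xs] by simp

section \<open>Existence of a triangle\<close>

lemma triangle_exists: "\<exists>a b c. {a, b, c} \<subseteq> V \<and> E a b \<and> E b c \<and> E a c"
proof (rule ccontr)
  assume no: "\<not> ?thesis"
  have no_tri: "\<not> (E a b \<and> E b c \<and> E a c)" for a b c
    using no edge_in by blast
  obtain v where v: "v \<in> V" using order by fastforce
  \<comment> \<open>\<open>N\<close> and \<open>M\<close> cover the at least 6 vertices other than
    \<open>v\<close>, so one of them contains three. In \<open>N\<close> these are pairwise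
    nonadjacent; in \<open>M\<close> some two of them are, and \<open>v\<close> completes the
    triple.\<close>
  define N M where N: "N = {u \<in> V. E v u}" and M: "M = {u \<in> V. u \<noteq> v \<and> \<not> E v u}"
  have "V = insert v (N \<union> M)" using v N M by auto
  then have "card V = card (insert v (N \<union> M))" by (rule arg_cong)
  also have "\<dots> \<le> Suc (card (N \<union> M))" using fin N M by (simp add: card_insert_if)
  also have "\<dots> \<le> Suc (card N + card M)" using card_Un_le by blast
  finally have "card V \<le> Suc (card N + card M)" .
  then have "3 \<le> card N \<or> 3 \<le> card M" using order by linarith
  then have "\<exists>a b c. {a, b, c} \<subseteq> V \<and> distinct [a, b, c] \<and> \<not> E a b \<and> \<not> E a c \<and> \<not> E b c"
  proof
    assume "3 \<le> card N"
    then obtain a b c where abc: "a \<in> N" "b \<in> N" "c \<in> N" "a \<noteq> b" "a \<noteq> c" "b \<noteq> c"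
      using card_ge_3_obtain by metis
    then have "\<not> E a b \<and> \<not> E a c \<and> \<not> E b c" using no_tri N by blast
    with abc N show ?thesis by auto
  next
    assume "3 \<le> card M"
    then obtain a b c where abc: "a \<in> M" "b \<in> M" "c \<in> M" "a \<noteq> b" "a \<noteq> c" "b \<noteq> c"
      using card_ge_3_obtain by metis
    then consider "\<not> E a b" | "\<not> E a c" | "\<not> E b c" using no_tri by blast
    then show ?thesis
    proof cases
      case 1 with abc v M show ?thesis by (intro exI[of _ v] exI[of _ a] exI[of _ b]) auto
    next
      case 2 with abc v M show ?thesis by (intro exI[of _ v] exI[of _ a] exI[of _ c]) auto
    next
      case 3 with abc v M show ?thesis by (intro exI[of _ v] exI[of _ b] exI[of _ c]) auto
    qed
  qed
  then obtain a b c where abc: "{a, b, c} \<subseteq> V" "distinct [a, b, c]"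
    "\<not> E a b" "\<not> E a c" "\<not> E b c" by blast
  let ?R = "V - set [a, b, c]"
  have "4 \<le> card ?R" using card_minus[of "[a, b, c]"] order by simp
  then obtain T where T: "T \<subseteq> ?R" "card T = 4" by (meson obtain_subset_with_card_n)
  have two: "E z a \<and> E z b \<or> E z a \<and> E z c \<or> E z b \<and> E z c" if "z \<in> ?R" for z
    using two_neighbours_in_triple[of a b c z] abc that by auto
  \<comment> \<open>Each of \<open>y\<close>, \<open>z\<close> sees two of the three vertices, so
    they have a common neighbour, and an edge between them would close a triangle.\<close>
  have "\<not> E y z" if "y \<in> ?R" "z \<in> ?R" for y z
    using two[OF that(1)] two[OF that(2)] no_tri sym by blast
  then have "induced_edges E T = {}" using T unfolding induced_edges_def by blast
  moreover have "2 \<le> card (induced_edges E T)" using st T unfolding st_graph_def by blast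
  ultimately show False by simp
qed

section \<open>Several neighbours on a cycle that cannot be extended\<close>

text \<open>\<open>hd A\<close>, \<open>hd B\<close> are the successors of \<open>u\<close>,
  \<open>v\<close>, and \<open>last B\<close>, \<open>last A\<close> their predecessors. Each denied
  adjacency, and each empty arc, would yield a cycle through \<open>x\<close> and all old
  vertices.\<close>

lemma two_neighbours:
  assumes ne: "\<And>ys. cycle V E ys \<Longrightarrow> length ys \<noteq> Suc k"
    and C: "cycle V E (u # A @ v # B)" and len: "length (u # A @ v # B) = k"
    and x: "x \<in> V" "x \<notin> set (u # A @ v # B)" and xu: "E x u" and xv: "E x v"
  shows "A \<noteq> []" "B \<noteq> []" "\<not> E x (hd A)" "\<not> E x (hd B)" "\<not> E x (last A)" "\<not> E x (last B)"
    "\<not> E (hd A) (hd B)" "\<not> E (last A) (last B)"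
proof -
  note cs = cycle_def successively_append_iff successively_Cons
  have symrev: "successively E (rev xs) = successively E xs" for xs
    using sym by (auto simp: successively_rev intro: successively_mono)
  have ux: "E u x" and vx: "E v x" using xu xv sym by auto
  show A: "A \<noteq> []"
    using ne[of "u # x # v # B"] C len x ux xv by (auto simp: cs)
  show B: "B \<noteq> []"
    using ne[of "u # A @ [v, x]"] C len x vx xu A by (auto simp: cs)
  note d = C len x ux vx xu xv A B
  show "\<not> E x (hd A)"
    using ne[of "u # x # A @ v # B"] d by (auto simp: cs)
  show "\<not> E x (hd B)"
    using ne[of "u # A @ v # x # B"] d by (auto simp: cs)
  show "\<not> E x (last A)"
    using ne[of "u # A @ x # v # B"] d sym[of x "last A"] by (auto simp: cs)
  show "\<not> E x (last B)"
    using ne[of "u # A @ v # B @ [x]"] d sym[of x "last B"] by (auto simp: cs)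
  \<comment> \<open>The detour \<open>u x v\<close> and the chord replace the two edges to the
    successors; \<open>A\<close> is traversed backwards.\<close>
  show "\<not> E (hd A) (hd B)"
    using ne[of "u # x # v # rev A @ B"] d sym[of "last A" v]
    by (auto simp: cs symrev hd_rev last_rev simp del: successively_rev)
  show "\<not> E (last A) (last B)"
    using ne[of "u # A @ rev B @ [v, x]"] d sym[of v "hd B"]
    by (auto simp: cs symrev hd_rev last_rev simp del: successively_rev)
qed

text \<open>The vertex \<open>x\<close> and the successors of its three neighbours would be pairwise
  nonadjacent. Each rotation of the cycle treats one pair of neighbours.\<close>

lemma no_three_neighbours:
  assumes ne: "\<And>ys. cycle V E ys \<Longrightarrow> length ys \<noteq> Suc k"
    and C: "cycle V E (u # A @ v # B @ w # D)" and len: "length (u # A @ v # B @ w # D) = k"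
    and x: "x \<in> V" "x \<notin> set (u # A @ v # B @ w # D)"
    and xu: "E x u" and xv: "E x v" and xw: "E x w"
  shows False
proof -
  have C2: "cycle V E (v # B @ w # (D @ u # A))"
    using cycle_rotate[of V E "u # A" "v # B @ w # D"] C by simp
  have C3: "cycle V E (w # D @ u # (A @ v # B))"
    using cycle_rotate[of V E "u # A @ v # B" "w # D"] C by simp
  have len2: "length (v # B @ w # (D @ u # A)) = k" and len3: "length (w # D @ u # (A @ v # B)) = k"
    using len by auto
  have x2: "x \<notin> set (v # B @ w # (D @ u # A))" and x3: "x \<notin> set (w # D @ u # (A @ v # B))"
    using x by auto
  note t1 = two_neighbours[OF ne C len x xu xv]
    and t2 = two_neighbours[OF ne C2 len2 x(1) x2 xv xw]
    and t3 = two_neighbours[OF ne C3 len3 x(1) x3 xw xu]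
  have A: "A \<noteq> []" "\<not> E x (hd A)" using t1 by auto
  have B: "B \<noteq> []" "\<not> E x (hd B)" using t2 by auto
  have D: "D \<noteq> []" "\<not> E x (hd D)" using t3 by auto
  have AB: "\<not> E (hd A) (hd B)" using t1(7) B by simp
  have BD: "\<not> E (hd B) (hd D)" using t2(7) D by simp
  have DA: "\<not> E (hd D) (hd A)" using t3(7) A by simp
  have in_sets: "hd A \<in> set A" "hd B \<in> set B" "hd D \<in> set D" using A B D by auto
  have "{x, hd A, hd B, hd D} \<subseteq> V" "distinct [x, hd A, hd B, hd D]"
    using C x in_sets unfolding cycle_def by auto
  then show False using no_five_nonedges[of x "hd A" "hd B" "hd D"] A B D AB DA sym[of "hd A" "hd D"] by blast
qed

text \<open>The arc from \<open>v\<close> back to \<open>u\<close> has a second inner vertex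
  \<open>hd B\<close>. The [4,2]-condition then forces the chords from \<open>hd B\<close> to
  \<open>hd A\<close> and from \<open>last A\<close> to \<open>b\<close>.\<close>

lemma no_two_neighbours_long:
  assumes ne: "\<And>ys. cycle V E ys \<Longrightarrow> length ys \<noteq> Suc k"
    and C: "cycle V E (u # A @ v # b # B)" and len: "length (u # A @ v # b # B) = k"
    and B: "B \<noteq> []"
    and x: "x \<in> V" "x \<notin> set (u # A @ v # b # B)" and xu: "E x u" and xv: "E x v"
  shows False
proof -
  note cs = cycle_def successively_append_iff successively_Cons
  have symrev: "successively E (rev xs) = successively E xs" for xs
    using sym by (auto simp: successively_rev intro: successively_mono)
  note t = two_neighbours[OF ne C len x xu xv]
  have A: "A \<noteq> []" using t by auto
  have in_sets: "hd A \<in> set A" "last A \<in> set A" "hd B \<in> set B" "last B \<in> set B" using A B by auto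
  have xB: "\<not> E x (hd B)"
  proof
    assume "E x (hd B)"
    moreover have eq: "b # B = [b] @ hd B # tl B" using B by simp
    ultimately show False
      using no_three_neighbours[OF ne C[unfolded eq] len[unfolded eq] x(1) x(2)[unfolded eq] xu xv]
      by blast
  qed
  have 1: "E (hd B) (hd A)"
  proof (rule ccontr)
    assume "\<not> E (hd B) (hd A)"
    moreover have "{x, hd A, b, hd B} \<subseteq> V" "distinct [x, hd A, b, hd B]"
      using C x in_sets unfolding cycle_def by auto
    ultimately show False using no_five_nonedges[of x "hd A" b "hd B"] t xB sym by auto
  qed
  have 2: "E (last A) b"
  proof (rule ccontr)
    assume "\<not> E (last A) b"
    moreover have "{x, last A, b, last B} \<subseteq> V" "distinct [x, last A, b, last B]"
      using C x in_sets unfolding cycle_def by auto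
    ultimately show False using no_five_nonedges[of x "last A" b "last B"] t B sym by auto
  qed
  \<comment> \<open>Both chords are used: from \<open>x\<close> and \<open>u\<close> backwards
    through \<open>B\<close>, across to \<open>A\<close> and forwards through it, then to
    \<open>b\<close>, \<open>v\<close> and back to \<open>x\<close>.\<close>
  show False
    using ne[of "x # u # rev B @ A @ [b, v]"] C len x xu xv A B 1 2 sym[of "last B" u] sym[of v b] sym[of x v]
    by (auto simp: cs symrev hd_rev last_rev simp del: successively_rev)
qed

text \<open>Without the bound on the order this fails for \<open>K\<^bsub>2,3\<^esub>\<close>.\<close>

lemma no_two_neighbours_4_cycle:
  assumes ne: "\<And>ys. cycle V E ys \<Longrightarrow> length ys \<noteq> Suc 4"
    and C: "cycle V E [u, a, v, b]"
    and x: "x \<in> V" "x \<notin> set [u, a, v, b]" and xu: "E x u" and xv: "E x v"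
  shows False
proof -
  have no5: False if "{p, q, r, s, t} \<subseteq> V" "distinct [p, q, r, s, t]"
    "E p q" "E q r" "E r s" "E s t" "E t p" for p q r s t
    using ne[of "[p, q, r, s, t]"] that by (auto simp: cycle_def)
  have t: "\<not> E x a" "\<not> E x b" "\<not> E a b"
    using two_neighbours[OF ne, of u "[a]" v "[b]" x] C x xu xv by auto
  have dist: "distinct [u, v, x, a, b]" and V: "{u, v, x, a, b} \<subseteq> V"
    and adj: "E u a" "E a v" "E v b" "E b u" using C x by (auto simp: cycle_def)
  have adj': "E a u" "E v a" "E b v" "E u b" "E u x" "E v x" using adj xu xv sym by auto
  \<comment> \<open>Both \<open>u\<close> and \<open>v\<close> are joined to all of the independent
    triple \<open>x\<close>, \<open>a\<close>, \<open>b\<close>.\<close>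
  have two: "E y x \<and> E y a \<or> E y x \<and> E y b \<or> E y a \<and> E y b"
    if "y \<in> V - set [u, v, x, a, b]" for y
    using two_neighbours_in_triple[of x a b y] dist V t that by auto
  \<comment> \<open>At least one of the two neighbours of \<open>y\<close> in the triple is
    \<open>x\<close> or \<open>a\<close>; an edge from \<open>y\<close> to \<open>u\<close> or
    \<open>v\<close> then closes a 5-cycle through it.\<close>
  have nu: "\<not> E u y \<and> \<not> E v y" if y: "y \<in> V - set [u, v, x, a, b]" for y
  proof -
    consider "E y x" | "E y a" using two[OF y] by blast
    then show ?thesis
    proof cases
      case 1
      then show ?thesis
        using no5[of u y x v a] no5[of v y x u a] y dist V adj adj' xu xv by auto
    next
      case 2
      then show ?thesis
        using no5[of u y a v x] no5[of v y a u x] y dist V adj adj' xu xv by auto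
    qed
  qed
  have "2 \<le> card (V - set [u, v, x, a, b])"
    using card_minus[of "[u, v, x, a, b]"] order by simp
  then obtain y z where y: "y \<in> V - set [u, v, x, a, b]" and z: "z \<in> V - set [u, v, x, a, b]"
    and yz: "y \<noteq> z" by (rule card_ge_2_obtain)
  \<comment> \<open>Otherwise \<open>u v\<close> would be the only possible edge among
    \<open>y\<close>, \<open>z\<close>, \<open>u\<close>, \<open>v\<close>. With distinct
    \<open>p\<close>, \<open>q\<close> from the triple, \<open>y p u q z\<close> then becomes a
    5-cycle.\<close>
  have "E y z"
    using no_five_nonedges[of y z u v] nu[OF y] nu[OF z] y z yz V dist sym by auto
  moreover have zy: "E z y" using \<open>E y z\<close> sym by blast
  moreover have path: False if "E y p" "E z q" "p \<noteq> q" "p \<in> {x, a, b}" "q \<in> {x, a, b}" for p q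
  proof -
    have "E p u" "E u q" using that adj adj' xu by auto
    then show False
      using no5[of y p u q z] that y z yz dist V zy sym[of z q] by auto
  qed
  ultimately show False using two[OF y] two[OF z] dist by auto
qed

lemma at_most_one_neighbour:
  assumes C: "cycle V E xs" and ne: "\<And>ys. cycle V E ys \<Longrightarrow> length ys \<noteq> Suc (length xs)"
    and x: "x \<in> V" "x \<notin> set xs" and u: "u \<in> set xs" "E x u" and v: "v \<in> set xs" "E x v"
  shows "u = v"
proof (rule ccontr)
  assume "u \<noteq> v"
  then obtain A B where AB: "cycle V E (u # A @ v # B)" "set (u # A @ v # B) = set xs"
    "length (u # A @ v # B) = length xs"
    using cycle_split_at[OF C u(1) v(1)] by metis
  note x' = x(1) x(2)[folded AB(2)]
  have "A \<noteq> []" "B \<noteq> []" using two_neighbours[OF ne AB(1,3) x' u(2) v(2)] by auto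
  then obtain a A' b B' where A: "A = a # A'" and B: "B = b # B'" by (meson neq_Nil_conv)
  \<comment> \<open>This rotation exchanges the two arcs, so that either one can serve as the long
    arc in \<open>no_two_neighbours_long\<close>.\<close>
  have C': "cycle V E (v # B @ u # a # A')"
    using cycle_rotate[of V E "u # A" "v # B"] AB(1) A by simp
  show False
  proof (cases "A' = [] \<and> B' = []")
    case True
    then have "length xs = 4" using AB(3) A B by simp
    with True show False
      using no_two_neighbours_4_cycle[OF ne[unfolded \<open>length xs = 4\<close>], of u a v b x]
        AB(1) A B x' u v by auto
  next
    case False
    then show False
      using no_two_neighbours_long[OF ne, of u A v b B' x]
        no_two_neighbours_long[OF ne C', of x] AB A B x' u v by auto
  qed
qed

section \<open>Extending a cycle by one vertex\<close>

text \<open>Among at least four cycle vertices, two are neighbours of neither \<open>x\<close> nor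
  \<open>y\<close>. If \<open>x\<close>, \<open>y\<close> were nonadjacent, these four vertices
  would span at most one edge.\<close>

lemma outside_clique:
  assumes C: "cycle V E xs" and len: "4 \<le> length xs"
    and ne: "\<And>ys. cycle V E ys \<Longrightarrow> length ys \<noteq> Suc (length xs)"
    and x: "x \<in> V - set xs" and y: "y \<in> V - set xs" and xy: "x \<noteq> y"
  shows "E x y"
proof (rule ccontr)
  assume nxy: "\<not> E x y"
  \<comment> \<open>A vertex without neighbours on the cycle is covered too: any \<open>p\<close>
    will do.\<close>
  have "\<exists>p. \<forall>u\<in>set xs. E z u \<longrightarrow> u = p" if "z \<in> V - set xs" for z
    using at_most_one_neighbour[OF C ne, of z] that by blast
  then obtain p q where p: "\<And>u. u \<in> set xs \<Longrightarrow> E x u \<Longrightarrow> u = p"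
    and q: "\<And>u. u \<in> set xs \<Longrightarrow> E y u \<Longrightarrow> u = q" using x y by metis
  have "card (set xs) - card {p, q} \<le> card (set xs - {p, q})"
    by (intro diff_card_le_card_Diff) simp
  moreover have "card (set xs) = length xs" using C by (simp add: cycle_def distinct_card)
  moreover have "card {p, q} \<le> 2" by (simp add: card_insert_if)
  ultimately have "2 \<le> card (set xs - {p, q})" using len by linarith
  then obtain u v where "u \<in> set xs - {p, q}" "v \<in> set xs - {p, q}" "u \<noteq> v"
    by (rule card_ge_2_obtain)
  moreover have "set xs \<subseteq> V" using C by (simp add: cycle_def)
  ultimately show False
    using no_five_nonedges[of x y u v] x y xy nxy p q by auto
qed

text \<open>One edge comes from connectedness, the other from connectedness after deleting
  \<open>p\<close>. Their outer ends differ because a vertex off the cycle has at most one neighbour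
  on it.\<close>

lemma disjoint_edges:
  assumes C: "cycle V E xs" and len: "3 \<le> length xs" "length xs < card V"
    and two: "two_connected V E"
    and ne: "\<And>ys. cycle V E ys \<Longrightarrow> length ys \<noteq> Suc (length xs)"
  obtains x y p q where "x \<in> V - set xs" "y \<in> V - set xs" "x \<noteq> y"
    "p \<in> set xs" "q \<in> set xs" "p \<noteq> q" "E x p" "E y q"
proof -
  have card_xs: "card (set xs) = length xs" and sub: "set xs \<subseteq> V"
    using C by (auto simp: cycle_def distinct_card)
  have out: "V - set xs \<noteq> {}" using card_xs len(2) sub by fastforce
  have "set xs \<noteq> {}" using len(1) by auto
  then obtain p x where p: "p \<in> set xs" and x: "x \<in> V - set xs" and px: "E p x"
    using connected_on_crossing_edge[of V E "set xs"] two sub out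
    unfolding two_connected_def by metis
  have "2 \<le> card (set xs - {p})" using p card_xs len(1) by simp
  then have "set xs - {p} \<noteq> {}" by force
  moreover have "connected_on (V - {p}) E" using two p sub unfolding two_connected_def by blast
  moreover have "V - {p} - (set xs - {p}) \<noteq> {}" using out p by blast
  moreover have "set xs - {p} \<subseteq> V - {p}" using sub by blast
  ultimately obtain q y where q: "q \<in> set xs - {p}" and y: "y \<in> V - {p} - (set xs - {p})"
    and qy: "E q y" by (metis connected_on_crossing_edge)
  have "x \<noteq> y" using at_most_one_neighbour[OF C ne, of x p q] x p q px qy sym by blast
  then show ?thesis using that[of x y p q] x y p q px qy sym by blast
qed

text \<open>Triangles are too short for \<open>outside_clique\<close>. Here \<open>x\<close>,
  \<open>y\<close>, \<open>c\<close> are independent, and a further vertex adjacent to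
  \<open>c\<close> and to one of \<open>x\<close>, \<open>y\<close> would close a 4-cycle through
  \<open>a\<close> or \<open>b\<close>.\<close>

lemma extend_3_cycle:
  assumes C: "cycle V E [a, b, c]" and x: "x \<in> V - {a, b, c}" and y: "y \<in> V - {a, b, c}"
    and xa: "E x a" and yb: "E y b" and xy: "x \<noteq> y"
    and ne: "\<And>ys. cycle V E ys \<Longrightarrow> length ys \<noteq> 4"
  shows False
proof -
  have no4: False if "{p, q, r, s} \<subseteq> V" "distinct [p, q, r, s]"
    "E p q" "E q r" "E r s" "E s p" for p q r s
    using ne[of "[p, q, r, s]"] that by (auto simp: cycle_def)
  have abc: "{a, b, c} \<subseteq> V" "distinct [a, b, c]" "E a b" "E b c" "E c a"
    using C by (auto simp: cycle_def)
  have abc': "E b a" "E c b" "E a c" using abc sym by auto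
  have nxc: "\<not> E x c" using no4[of x c b a] abc abc' x xa sym by auto
  have nyc: "\<not> E y c" using no4[of y c a b] abc abc' y yb sym by auto
  have nxy: "\<not> E x y" using no4[of x y b a] abc abc' x y xy xa yb sym by auto
  have both: "E z x \<and> E z y" if z: "z \<in> V - set [a, b, c, x, y]" for z
  proof -
    have "E z x \<and> E z y \<or> E z x \<and> E z c \<or> E z y \<and> E z c"
      using two_neighbours_in_triple[of x y c z] x y xy abc nxc nyc nxy z by auto
    moreover have "\<not> (E z x \<and> E z c)"
      using no4[of z x a c] abc abc' x xa z sym by auto
    moreover have "\<not> (E z y \<and> E z c)"
      using no4[of z y b c] abc abc' y yb z sym by auto
    ultimately show ?thesis by blast
  qed
  have "2 \<le> card (V - set [a, b, c, x, y])"
    using card_minus[of "[a, b, c, x, y]"] order by simp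
  then obtain z w where "z \<in> V - set [a, b, c, x, y]" "w \<in> V - set [a, b, c, x, y]" "z \<noteq> w"
    by (rule card_ge_2_obtain)
  then show False using no4[of z x w y] both x y xy sym by auto
qed

lemma extend_cycle:
  assumes C: "cycle V E xs" and len: "3 \<le> length xs" "length xs < card V"
    and two: "two_connected V E"
  shows "\<exists>ys. cycle V E ys \<and> length ys = Suc (length xs)"
proof (rule ccontr)
  assume "\<not> ?thesis"
  then have ne: "length ys \<noteq> Suc (length xs)" if "cycle V E ys" for ys using that by blast
  obtain x y p q where x: "x \<in> V - set xs" and y: "y \<in> V - set xs" and xy: "x \<noteq> y"
    and p: "p \<in> set xs" and q: "q \<in> set xs" and pq: "p \<noteq> q" and xp: "E x p" and yq: "E y q"
    using disjoint_edges[OF C len two ne] by metis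
  obtain A B where AB: "cycle V E (p # A @ q # B)" "set (p # A @ q # B) = set xs"
    "length (p # A @ q # B) = length xs"
    using cycle_split_at[OF C p q pq] by metis
  have sub: "set xs \<subseteq> V" using C by (simp add: cycle_def)
  consider "length xs = 3" | "length xs = 4" | "5 \<le> length xs" using len by linarith
  then show False
  proof cases
    case 1
    then have "length A + length B = 1" using AB(3) by simp
    then consider c where "A = []" "B = [c]" | c where "A = [c]" "B = []"
      by (cases A; cases B) auto
    then show False
    proof cases
      case 1
      then show False
        using extend_3_cycle[of p q c x y] AB x y xp yq xy ne \<open>length xs = 3\<close> by force
    next
      case 2
      \<comment> \<open>With \<open>q\<close> and \<open>p\<close> in front,
        \<open>extend_3_cycle\<close> applies with the two outgoing edges exchanged.\<close>
      then have "cycle V E [q, p, c]" using AB(1) cycle_rotate[of V E "[p, c]" "[q]"] by simp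
      with 2 show False
        using extend_3_cycle[of q p c y x] AB x y xp yq xy ne \<open>length xs = 3\<close> by force
    qed
  next
    case 2
    have out: "E w z" if "w \<in> V - set xs" "z \<in> V - set xs" "w \<noteq> z" for w z
      using outside_clique[OF C _ ne that] 2 by simp
    have no5: False if "{p, q, r, s, t} \<subseteq> V" "distinct [p, q, r, s, t]"
      "E p q" "E q r" "E r s" "E s t" "E t p" for p q r s t
      using ne[of "[p, q, r, s, t]"] that 2 by (auto simp: cycle_def)
    have "card (V - set (x # y # xs)) \<ge> 1"
      using card_minus[of "x # y # xs"] order 2 by simp
    then have "V - set (x # y # xs) \<noteq> {}" by (metis card.empty not_one_le_zero)
    then have "\<exists>z. z \<in> V - set (x # y # xs)" by blast
    then obtain z where z: "z \<in> V - set xs" "z \<noteq> x" "z \<noteq> y" by auto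
    \<comment> \<open>If \<open>p\<close>, \<open>q\<close> were adjacent, \<open>z\<close> would
      pad the route to the 5-cycle \<open>x z y q p\<close>. So they are opposite on the 4-cycle,
      and a common neighbour \<open>a\<close> gives \<open>x y q a p\<close>.\<close>
    have npq: "\<not> E q p"
      using no5[of x z y q p] out x y z xy p q pq sub xp yq sym by auto
    then have "A \<noteq> []" "B \<noteq> []" using AB(1) sym by (auto simp: cycle_def)
    then obtain a where "A = [a]" using 2 AB(3) by (cases A; cases B) auto
    then have "E p a" "E a q" "a \<in> set xs" "a \<noteq> p" "a \<noteq> q" using AB by (auto simp: cycle_def)
    then show False
      using no5[of x y q a p] out x y xy p q pq sub xp yq sym by auto
  next
    case 3
    have Exy: "E x y" using outside_clique[OF C _ ne x y xy] 3 by simp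
    let ?W = "set xs - {p, q}"
    have nx: "\<not> E u x" "\<not> E u y" if "u \<in> ?W" for u
      using at_most_one_neighbour[OF C ne, of x p u] at_most_one_neighbour[OF C ne, of y q u]
        that x y p q xp yq sym by auto
    \<comment> \<open>No edge joins \<open>u\<close> or \<open>v\<close> to \<open>x\<close> or
      \<open>y\<close>, so a missing edge \<open>u v\<close> would leave only the edge
      \<open>x y\<close>.\<close>
    have clique: "E u v" if "u \<in> ?W" "v \<in> ?W" "u \<noteq> v" for u v
      using no_five_nonedges[of u v x y] nx that x y xy sub by auto
    have d: "distinct (p # A @ q # B)" using AB(1) by (simp add: cycle_def)
    \<comment> \<open>These are the ends of the path through \<open>?W\<close>. If one arc is empty,
      the other has at least two vertices and supplies both ends; otherwise each arc supplies
      one.\<close>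
    have "\<exists>a b. a \<in> set A \<union> set B \<and> b \<in> set A \<union> set B \<and> a \<noteq> b \<and> E p a \<and> E b q"
    proof (cases "A = []")
      case True
      then have "2 \<le> length B" using AB(3) 3 by simp
      then have "B \<noteq> []" "hd B \<noteq> last B" using d by (cases B; auto)+
      with True show ?thesis using AB(1) sym
        by (intro exI[of _ "last B"] exI[of _ "hd B"])
          (auto simp: cycle_def successively_Cons)
    next
      case A: False
      then have EA: "E p (hd A)" "E (last A) q" using AB(1)
        by (auto simp: cycle_def successively_append_iff successively_Cons)
      show ?thesis
      proof (cases "B = []")
        case True
        then have "2 \<le> length A" using AB(3) 3 by simp
        then have "hd A \<noteq> last A" using d by (cases A) auto
        with A EA show ?thesis by (intro exI[of _ "hd A"] exI[of _ "last A"]) auto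
      next
        case False
        then have "hd B \<in> set B" "hd A \<in> set A" using A by auto
        moreover have "E (hd B) q" using AB(1) False sym
          by (auto simp: cycle_def successively_append_iff successively_Cons)
        ultimately show ?thesis using EA d
          by (intro exI[of _ "hd A"] exI[of _ "hd B"]) auto
      qed
    qed
    moreover have "set A \<union> set B = ?W" using AB(2) d by auto
    ultimately obtain a b where a: "a \<in> ?W" and b: "b \<in> ?W" and ab: "a \<noteq> b"
      and pa: "E p a" and bq: "E b q" by blast
    have card_xs: "card (set xs) = length xs" using C by (simp add: cycle_def distinct_card)
    have "card (set xs - {p, q, a, b}) = length xs - 4"
      using p q pq a b ab card_xs by (subst card_Diff_subset) auto
    then have "card (set xs - {p, q, a, b}) \<noteq> 0" using 3 by simp
    \<comment> \<open>\<open>c\<close> is the vertex left out: \<open>x\<close> and \<open>y\<close>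
      enter and \<open>c\<close> leaves, so the length grows by exactly one.\<close>
    then obtain c where c: "c \<in> set xs - {p, q, a, b}" by (metis card.empty ex_in_conv)
    have card5: "card (set xs - {p, q, a, b, c}) = length xs - 5"
      using p q pq a b ab c card_xs by (subst card_Diff_subset) auto
    \<comment> \<open>Any order of the remaining vertices gives a path, since \<open>?W\<close> is a
      clique.\<close>
    obtain L where L: "set L = set xs - {p, q, a, b, c}" "distinct L"
      using finite_distinct_list[of "set xs - {p, q, a, b, c}"] by auto
    then have lenL: "length L = length xs - 5" using card5 distinct_card by metis
    define P where P: "P = a # L @ [b]"
    have W: "set P \<subseteq> ?W" "distinct P" unfolding P using a b ab L by auto
    then have "successively E P" using clique by (intro successively_clique) blast+
    moreover have "P \<noteq> []" "hd P = a" "last P = b" unfolding P by auto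
    moreover have "distinct (x # p # P @ [q, y])" using W x y xy p q pq by auto
    moreover have "set (x # p # P @ [q, y]) \<subseteq> V" using W x y p q sub by auto
    ultimately have cyc: "cycle V E (x # p # P @ [q, y])"
      using xp pa bq sym[OF yq] sym[OF Exy]
      unfolding cycle_def by (simp add: successively_append_iff successively_Cons)
    show False using ne[OF cyc] lenL 3 P by simp
  qed
qed

section \<open>Cycles of all lengths, by induction from the triangle\<close>

lemma pancyclic:
  assumes "two_connected V E"
  shows "pancyclic V E"
  unfolding pancyclic_def
proof (intro allI impI)
  fix k :: nat
  assume k: "3 \<le> k \<and> k \<le> card V"
  then have "3 \<le> k" by simp
  then have "k \<le> card V \<Longrightarrow> \<exists>xs. length xs = k \<and> cycle V E xs"
  proof (induction k rule: dec_induct)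
    case base
    obtain a b c where "{a, b, c} \<subseteq> V" "E a b" "E b c" "E a c" using triangle_exists by blast
    then show ?case using irrefl sym by (intro exI[of _ "[a, b, c]"]) (auto simp: cycle_def)
  next
    case (step k)
    then obtain xs where "length xs = k" "cycle V E xs" by auto
    then show ?case using extend_cycle[of xs] step.hyps step.prems assms by auto
  qed
  then show "has_cycle_of_length V E k" using k by (simp add: has_cycle_iff)
qed

end

theorem theorem6:
  fixes V :: "'a set" and E :: "'a \<Rightarrow> 'a \<Rightarrow> bool"
  assumes "simple_graph V E"
    and "7 \<le> card V"
    and "two_connected V E"
    and "st_graph 4 2 V E"
  shows "pancyclic V E"
proof -
  interpret graph_4_2 V E by unfold_locales (use assms in auto)
  show ?thesis using pancyclic assms(3) by blast
qed

end
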